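(* For a set $\mathcal{I}$ of functions on a probability space, the following are equivalent: (1) For all $n$, we have $E_n(f_1,\ldots,f_n)\ge 0$ if $f_1,\ldots,f_n\in\mathcal{I}$. (2) The power series $$1-\exp\Big(\mathcal{E}\big(\log\big(1-\textstyle\sum_{i} f_i t^i\big)\big)\Big)$$ has non-negative coefficients if $f_1,f_2,\ldots\in\mathcal{I}$.
   Context: For a function $f$ on a probability space $(L,\mu)$, $\mathcal{E}(f)=\int_L f\,d\mu$ denotes its expectation. In (2) the sum is over $i\ge 1$ and the series is a formal power series in $t$: the logarithm is the formal power series obtained from $\log(1-A)=-\sum_{j\ge1}A^j/j$ with $A=\sum_{i}f_it^i$, $\mathcal{E}$ is applied coefficientwise, and $\exp$ is the formal exponential. For $\sigma$ in the symmetric group $S_n$ with disjoint cycle decomposition $\sigma=(i_1,\ldots,i_p)(j_1,\ldots,j_q)\cdots$ (fixed points included as cycles of length 1), let $C_\sigma$ be the number of cycles in $\sigma$ and $$E_\sigma(f_1,\ldots,f_n)=\mathcal{E}(f_{i_1}\cdots f_{i_p})\,\mathcal{E}(f_{j_1}\cdots f_{j_q})\cdots .$$ Then $E_n(f_1,\ldots,f_n)=\sum_{\sigma\in S_n}(-1)^{C_\sigma-1}E_\sigma(f_1,\ldots,f_n)$.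
   Formalization: In (2) each f_i may also be the zero function (a term may be absent); if all f_i must lie in a set without 0, (2) does not imply (1): take the single function equal to 1/2 with probability 2/3 and -1 with probability 1/3. Finite products of functions in the set are assumed integrable. *)

theory Defs
  imports
    "HOL-Analysis.Analysis"
    "HOL-Combinatorics.Combinatorics"
    "HOL-Combinatorics.Orbits"
    "HOL-Computational_Algebra.Formal_Power_Series"
    "HOL-Probability.Probability_Measure"
begin

(* The supports of the disjoint cycles of a permutation s of {1..n}; a fixed point i contributes {i}.
   The cyclic order within a cycle plays no role below because the functions commute. *)
definition cycle_sets :: "nat \<Rightarrow> (nat \<Rightarrow> nat) \<Rightarrow> nat set set" where
  "cycle_sets n s = orbit s ` {1..n}"

definition E_perm :: "'a measure \<Rightarrow> nat \<Rightarrow> (nat \<Rightarrow> nat) \<Rightarrow> (nat \<Rightarrow> 'a \<Rightarrow> real) \<Rightarrow> real" where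
  "E_perm M n s f = (\<Prod>c\<in>cycle_sets n s. \<integral>x. (\<Prod>i\<in>c. f i x) \<partial>M)"

(* Meant for n \<ge> 1, where card (cycle_sets n s) \<ge> 1 and the subtraction does not truncate. *)
definition E_n :: "'a measure \<Rightarrow> nat \<Rightarrow> (nat \<Rightarrow> 'a \<Rightarrow> real) \<Rightarrow> real" where
  "E_n M n f = (\<Sum>s | s permutes {1..n}. (- 1) ^ (card (cycle_sets n s) - 1) * E_perm M n s f)"

(* Formal logarithm of a power series with constant coefficient 1; fps_ln 1 is the series of log (1 + X). *)
definition fps_log :: "real fps \<Rightarrow> real fps" where
  "fps_log F = fps_ln 1 oo (F - 1)"

lemma fps_log_one_minus_nth:
  assumes "fps_nth A 0 = 0"
  shows "fps_nth (fps_log (1 - A)) n = - (\<Sum>j=1..n. fps_nth (A ^ j) n / real j)"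
proof -
  have sgn: "(- 1) ^ (j - 1) * fps_nth ((- A) ^ j) n = - fps_nth (A ^ j) n" if "j \<ge> 1" for j
  proof -
    from that obtain m where m: "j = Suc m" using not0_implies_Suc by fastforce
    have "(- A) ^ j = (if even j then A ^ j else - (A ^ j))"
      by (simp add: power_minus_even power_minus_odd)
    then show ?thesis using m by (cases "even j") auto
  qed
  have "fps_nth (fps_log (1 - A)) n = (\<Sum>j=0..n. fps_nth (fps_ln 1) j * fps_nth ((- A) ^ j) n)"
    by (simp add: fps_log_def fps_compose_nth)
  also have "\<dots> = (\<Sum>j=1..n. fps_nth (fps_ln 1) j * fps_nth ((- A) ^ j) n)"
    by (rule sum.mono_neutral_right) (auto simp: not_less_eq_eq)
  also have "\<dots> = (\<Sum>j=1..n. - (fps_nth (A ^ j) n / real j))"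
  proof (rule sum.cong[OF refl])
    fix j assume "j \<in> {1..n}"
    then have "j \<ge> 1" by simp
    then show "fps_nth (fps_ln 1) j * fps_nth ((- A) ^ j) n = - (fps_nth (A ^ j) n / real j)"
      using sgn[of j] by (simp add: fps_ln_nth)
  qed
  finally show ?thesis by (simp add: sum_negf)
qed

(* A power series whose coefficients are functions on the space is a pointwise family of real
   power series. *)
definition fps_expectation :: "'a measure \<Rightarrow> ('a \<Rightarrow> real fps) \<Rightarrow> real fps" where
  "fps_expectation M F = Abs_fps (\<lambda>k. \<integral>x. fps_nth (F x) k \<partial>M)"

(* f 0 is ignored: the sum over i starts at i = 1. A sum over only some of the indices i (finite, or
   with gaps) is encoded by f i = 0 at the others. Such sums matter for sets of functions that do not
   contain 0: for the single function with value 1/2 with probability 2/3 and -1 with probability 1/3,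
   the series with all f i equal to it has non-negative coefficients, although E_3 is negative. *)
definition gen_series :: "(nat \<Rightarrow> 'a \<Rightarrow> real) \<Rightarrow> 'a \<Rightarrow> real fps" where
  "gen_series f x = Abs_fps (\<lambda>i. if i = 0 then 0 else f i x)"

definition positivity_series :: "'a measure \<Rightarrow> (nat \<Rightarrow> 'a \<Rightarrow> real) \<Rightarrow> real fps" where
  "positivity_series M f = 1 - (fps_exp 1 oo fps_expectation M (\<lambda>x. fps_log (1 - gen_series f x)))"

end

theory Submission
  imports Defs
begin

text \<open>The equivalence rests on the expansion \<open>positivity_series_nth\<close>: the coefficient of \<open>t\<^sup>k\<close> in
  \<open>1 - exp (E (log (1 - \<Sum>i. f\<^sub>i t\<^sup>i)))\<close> is the sum, over all \<open>n\<close> and all sequences \<open>e\<close> of \<open>n\<close> positive exponents with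
  sum \<open>k\<close>, of \<open>E_n\<close> of the functions \<open>f (e i)\<close>, divided by \<open>n!\<close>. It is the exponential formula for
  permutations: if every cycle of length \<open>j\<close> has weight \<open>c j\<close>, then \<open>exp (\<Sum>j. c j / j)\<close> is the sum over
  \<open>n\<close> of the total weight of the permutations of \<open>n\<close> letters divided by \<open>n!\<close>
  (\<open>exp_compose_eq_sum_cycle_index\<close>). Here \<open>c j\<close> is minus the \<open>j\<close>-th moment of \<open>\<Sum>i. f\<^sub>i t\<^sup>i\<close>, and since
  the cycles partition the letters, expanding all moments gives the sum over \<open>e\<close>
  (\<open>cycle_sum_sum_PiE\<close>).

  If every \<open>E_n\<close> is non-negative on \<open>I\<close>, so is every term of the expansion, the terms in which some
  \<open>f (e i)\<close> is the zero function being zero. Conversely, to isolate \<open>E_n\<close> of given \<open>g\<^sub>1, \<dots>, g\<^sub>n\<close>,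
  the \<open>g\<^sub>i\<close> are placed at exponents whose total \<open>k\<close> is not the sum of any other multiset of
  these exponents (\<open>sum_exponent_unique\<close>), and zero at all others. Then only permutations of the \<open>g\<^sub>i\<close>
  contribute to the coefficient of \<open>t\<^sup>k\<close>, and \<open>E_n\<close> is symmetric (\<open>E_n_permute\<close>), so that coefficient is
  a positive multiple of \<open>E_n\<close> of \<open>g\<^sub>1, \<dots>, g\<^sub>n\<close>.\<close>

section \<open>Sums over permutations of products over cycles\<close>

definition cycle_sum :: "'b set \<Rightarrow> ('b set \<Rightarrow> 'c::comm_ring_1) \<Rightarrow> 'c" where
  "cycle_sum S w = (\<Sum>\<sigma> | \<sigma> permutes S. \<Prod>c\<in>orbit \<sigma> ` S. w c)"

lemma cycle_sum_empty [simp]: "cycle_sum {} w = 1"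
  by (simp add: cycle_sum_def)

lemma cycle_sum_cong:
  assumes "\<And>c. c \<subseteq> S \<Longrightarrow> c \<noteq> {} \<Longrightarrow> w c = w' c"
  shows "cycle_sum S w = cycle_sum S w'"
  unfolding cycle_sum_def
  by (intro sum.cong prod.cong refl)
     (use permutes_orbit_subset orbit_nonempty in \<open>fastforce intro!: assms\<close>)

lemma orbits_insert_fixed:
  assumes "q permutes S" "a \<notin> S"
  shows "orbit q ` insert a S = insert {a} (orbit q ` S)"
  using assms by (simp add: orbit_eq_singleton_iff[THEN iffD2] permutes_not_in)

text \<open>Composing with the transposition of \<open>a\<close> and \<open>b\<close>, where \<open>q\<close> fixes \<open>a\<close>, inserts \<open>a\<close> into the cycle
  of \<open>b\<close> right before \<open>b\<close>: the preimage of \<open>b\<close> is now sent to \<open>a\<close>, and \<open>a\<close> to \<open>b\<close>.\<close>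
lemma orbit_transpose_comp:
  assumes "finite S" "q permutes S" "a \<notin> S" "b \<in> S"
  shows "orbit (Transposition.transpose a b \<circ> q) a = insert a (orbit q b)" (is "orbit ?p a = _")
proof (intro set_eqI iffI)
  have qa: "q a = a" using assms by (simp add: permutes_not_in)
  have qS: "q y \<in> S \<longleftrightarrow> y \<in> S" for y using assms by (simp add: permutes_in_image)
  have self: "b \<in> orbit q b"
    using assms by (intro permutation_self_in_orbit) (auto simp: permutation_permutes)
  have sub: "orbit q b \<subseteq> S" using assms by (intro permutes_orbit_subset)
  have inS: "?p y \<in> insert a (orbit q b)" if "y \<in> insert a (orbit q b)" for y
    using that self by (auto simp: qa Transposition.transpose_def intro: orbit.intros)
  show "y \<in> insert a (orbit q b)" if "y \<in> orbit ?p a" for y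
    using that by induction (use inS in auto)
  have b: "b \<in> orbit ?p a"
    using orbit.base[of ?p a] qa by simp
  have step: "q y \<in> orbit ?p a" if "y \<in> orbit ?p a" "y \<in> S" for y
  proof (cases "q y = b")
    case False
    moreover have "q y \<noteq> a" using that(2) assms(3) qS by metis
    ultimately have "?p y = q y" by simp
    then show ?thesis using orbit.step[OF that(1)] by simp
  qed (use b in simp)
  have orb: "y \<in> orbit ?p a" if "y \<in> orbit q b" for y
    using that by induction (use step b sub assms(4) in \<open>blast+\<close>)
  moreover have "a \<in> orbit ?p a"
  proof -
    \<comment> \<open>The predecessor of \<open>b\<close> in its cycle is what the composition sends to \<open>a\<close>.\<close>
    obtain y where y: "y \<in> orbit q b" "q y = b"
      using self by (metis orbit.simps)
    then have "?p y = a" by simp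
    then show ?thesis using orbit.step[OF orb[OF y(1)]] by simp
  qed
  ultimately show "y \<in> orbit ?p a" if "y \<in> insert a (orbit q b)" for y
    using that by auto
qed

lemma orbits_transpose_comp:
  assumes "finite S" "q permutes S" "a \<notin> S" "b \<in> S"
  shows "orbit (Transposition.transpose a b \<circ> q) ` insert a S =
         (\<lambda>c. if b \<in> c then insert a c else c) ` orbit q ` S" (is "orbit ?p ` _ = ?g ` _")
proof -
  have perm: "permutation q" using assms(1,2) permutation_permutes by blast
  have pperm: "?p permutes insert a S"
    using assms by (auto intro!: permutes_compose permutes_swap_id intro: permutes_imp_permutes_insert)
  have cyc: "cyclic_on ?p (orbit ?p x)" for x
    using pperm assms(1) by (intro cyclic_on_orbit[of _ "insert a S"]) auto
  have self: "x \<in> orbit q x" for x using perm by (rule permutation_self_in_orbit)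
  have sub: "orbit q x \<subseteq> S" if "x \<in> S" for x using that assms permutes_orbit_subset by metis
  have a: "orbit ?p a = insert a (orbit q b)" by (rule orbit_transpose_comp[OF assms])
  have ga: "orbit ?p a = ?g (orbit q b)" using a self by simp
  have gx: "orbit ?p x = ?g (orbit q x)" if x: "x \<in> S" for x
  proof (cases "b \<in> orbit q x")
    case True
    then have eq: "orbit q x = orbit q b"
      using cyclic_on_orbit'[OF perm, of x] orbit_cyclic_eq3 by metis
    then have "x \<in> orbit ?p a" using a self[of x] by simp
    then have "orbit ?p x = orbit ?p a" using cyc orbit_cyclic_eq3 by metis
    then show ?thesis using ga eq by simp
  next
    case False
    have "orbit ?p x = orbit q x"
    proof (rule orbit_cong)
      show "x \<in> orbit q x" by (rule self)
      fix y assume "y \<in> orbit q x"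
      then have "q y \<in> orbit q x" by (rule orbit.step)
      with False sub[OF x] assms(3) have "q y \<noteq> b" "q y \<noteq> a" by auto
      then show "?p y = q y" by simp
    qed
    with False show ?thesis by simp
  qed
  have "orbit ?p a = orbit ?p b" by (simp only: ga gx[OF assms(4)])
  then have "orbit ?p ` insert a S = orbit ?p ` S"
    using assms(4) by blast
  also have "\<dots> = ?g ` orbit q ` S" using gx by (auto simp: image_image intro!: image_cong)
  finally show ?thesis .
qed

text \<open>Deleting \<open>a\<close> from a permutation of \<open>insert a S\<close> leaves a permutation of \<open>S\<close>; conversely \<open>a\<close> is put
  back either as a fixed point or right before some \<open>b\<close>. In the second case only the weight of the
  cycle through \<open>b\<close> changes, so the contribution is again a cycle sum over \<open>S\<close>, for a modified
  weight. This is why weights on arbitrary subsets are considered.\<close>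
lemma cycle_sum_insert_merge:
  assumes "finite S" "a \<notin> S"
  shows "cycle_sum (insert a S) w =
         w {a} * cycle_sum S w + (\<Sum>b\<in>S. cycle_sum S (\<lambda>c. w (if b \<in> c then insert a c else c)))"
proof -
  have fixed: "(\<Prod>c\<in>orbit q ` insert a S. w c) = w {a} * (\<Prod>c\<in>orbit q ` S. w c)" if "q permutes S" for q
  proof -
    have "{a} \<notin> orbit q ` S" using permutes_orbit_subset[OF that] assms(2) by blast
    then show ?thesis unfolding orbits_insert_fixed[OF that assms(2)] using assms(1) by simp
  qed
  have merged: "(\<Prod>c\<in>orbit (Transposition.transpose a b \<circ> q) ` insert a S. w c) =
                (\<Prod>c\<in>orbit q ` S. w (if b \<in> c then insert a c else c))"
    if "q permutes S" "b \<in> S" for q b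
  proof -
    have "a \<notin> c" if "c \<in> orbit q ` S" for c
      using permutes_orbit_subset[OF \<open>q permutes S\<close>] that assms(2) by blast
    then have "inj_on (\<lambda>c. if b \<in> c then insert a c else c) (orbit q ` S)"
      by (intro inj_onI) (metis insert_ident insertI2)
    then show ?thesis
      unfolding orbits_transpose_comp[OF assms(1) that(1) assms(2) that(2)]
      by (simp only: prod.reindex o_def)
  qed
  have "cycle_sum (insert a S) w =
        (\<Sum>b\<in>insert a S. \<Sum>q | q permutes S. \<Prod>c\<in>orbit (Transposition.transpose a b \<circ> q) ` insert a S. w c)"
    unfolding cycle_sum_def by (rule sum_over_permutations_insert[OF assms])
  also have "\<dots> = (\<Sum>q | q permutes S. \<Prod>c\<in>orbit q ` insert a S. w c) +
    (\<Sum>b\<in>S. \<Sum>q | q permutes S. \<Prod>c\<in>orbit (Transposition.transpose a b \<circ> q) ` insert a S. w c)"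
    using assms by (simp del: image_insert)
  also have "\<dots> = w {a} * cycle_sum S w + (\<Sum>b\<in>S. cycle_sum S (\<lambda>c. w (if b \<in> c then insert a c else c)))"
    using fixed merged by (simp add: cycle_sum_def sum_distrib_left del: image_insert)
  finally show ?thesis .
qed

text \<open>Summation by the support \<open>insert a T\<close> of the cycle of \<open>a\<close>; the factorial counts the cyclic orders on
  that support. By induction from the merging step, for all weights simultaneously: each nonempty \<open>T\<close>
  arises once for every choice of \<open>b \<in> T\<close>, which turns \<open>fact (card T - 1)\<close> into \<open>fact (card T)\<close>.\<close>
lemma cycle_sum_insert:
  fixes w :: "'b set \<Rightarrow> 'c::comm_ring_1"
  assumes "finite S" "a \<notin> S"
  shows "cycle_sum (insert a S) w =
         (\<Sum>T\<in>Pow S. of_nat (fact (card T)) * w (insert a T) * cycle_sum (S - T) w)"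
  using assms
proof (induction "card S" arbitrary: S a w rule: less_induct)
  case less
  note fin = \<open>finite S\<close>
  have "cycle_sum S (\<lambda>c. w (if b \<in> c then insert a c else c)) =
        (\<Sum>T\<in>Pow S. if b \<in> T then of_nat (fact (card T - 1)) * w (insert a T) * cycle_sum (S - T) w else 0)"
    if b: "b \<in> S" for b
  proof -
    have card_insert: "card (insert b T) - Suc 0 = card T" if "T \<subseteq> S - {b}" for T
    proof -
      have "finite T" "b \<notin> T" using that fin finite_subset by auto
      then show ?thesis by simp
    qed
    have "card S > 0" using b fin by (auto simp: card_gt_0_iff)
    let ?w = "\<lambda>c. w (if b \<in> c then insert a c else c)"
    have "cycle_sum S ?w = cycle_sum (insert b (S - {b})) ?w"
      using b by (simp add: insert_absorb)
    also have "\<dots> = (\<Sum>T\<in>Pow (S - {b}). of_nat (fact (card T)) * ?w (insert b T) * cycle_sum (S - {b} - T) ?w)"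
      using b fin \<open>card S > 0\<close> by (intro less.hyps) auto
    also have "\<dots> = (\<Sum>T\<in>Pow (S - {b}). of_nat (fact (card T)) * w (insert a (insert b T)) * cycle_sum (S - insert b T) w)"
    proof (intro sum.cong refl)
      fix T assume "T \<in> Pow (S - {b})"
      have "cycle_sum (S - {b} - T) ?w = cycle_sum (S - {b} - T) w"
        by (rule cycle_sum_cong) auto
      moreover have "S - {b} - T = S - insert b T" by auto
      ultimately show "of_nat (fact (card T)) * ?w (insert b T) * cycle_sum (S - {b} - T) ?w =
          of_nat (fact (card T)) * w (insert a (insert b T)) * cycle_sum (S - insert b T) w" by simp
    qed
    also have "\<dots> = (\<Sum>T | T \<in> Pow S \<and> b \<in> T. of_nat (fact (card T - 1)) * w (insert a T) * cycle_sum (S - T) w)"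
      by (rule sum.reindex_bij_witness[of _ "\<lambda>T. T - {b}" "insert b"])
         (use b in \<open>auto simp: insert_absorb card_insert\<close>)
    also have "\<dots> = (\<Sum>T\<in>Pow S. if b \<in> T then of_nat (fact (card T - 1)) * w (insert a T) * cycle_sum (S - T) w else 0)"
      using fin by (subst sum.inter_filter [symmetric]) auto
    finally show ?thesis .
  qed
  then have "(\<Sum>b\<in>S. cycle_sum S (\<lambda>c. w (if b \<in> c then insert a c else c))) =
      (\<Sum>b\<in>S. \<Sum>T\<in>Pow S. if b \<in> T then of_nat (fact (card T - 1)) * w (insert a T) * cycle_sum (S - T) w else 0)"
    by simp
  also have "\<dots> = (\<Sum>T\<in>Pow S. \<Sum>b\<in>S. if b \<in> T then of_nat (fact (card T - 1)) * w (insert a T) * cycle_sum (S - T) w else 0)"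
    by (rule sum.swap)
  also have "\<dots> = (\<Sum>T\<in>Pow S. of_nat (card T) * (of_nat (fact (card T - 1)) * w (insert a T) * cycle_sum (S - T) w))"
  proof (intro sum.cong refl)
    fix T assume "T \<in> Pow S"
    then have "S \<inter> T = T" by auto
    then show "(\<Sum>b\<in>S. if b \<in> T then of_nat (fact (card T - 1)) * w (insert a T) * cycle_sum (S - T) w else 0) =
      of_nat (card T) * (of_nat (fact (card T - 1)) * w (insert a T) * cycle_sum (S - T) w)"
      using fin by (simp add: sum.If_cases)
  qed
  also have "\<dots> = (\<Sum>T\<in>Pow S - {{}}. of_nat (card T) * (of_nat (fact (card T - 1)) * w (insert a T) * cycle_sum (S - T) w))"
    using fin by (intro sum.mono_neutral_right) auto
  also have "\<dots> = (\<Sum>T\<in>Pow S - {{}}. of_nat (fact (card T)) * w (insert a T) * cycle_sum (S - T) w)"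
  proof (intro sum.cong refl)
    fix T assume "T \<in> Pow S - {{}}"
    then have "card T > 0" using fin by (auto simp: card_gt_0_iff finite_subset)
    then have "of_nat (fact (card T)) = (of_nat (card T) * of_nat (fact (card T - 1)) :: 'c)"
      by (simp add: fact_reduce)
    then show "of_nat (card T) * (of_nat (fact (card T - 1)) * w (insert a T) * cycle_sum (S - T) w) =
      of_nat (fact (card T)) * w (insert a T) * cycle_sum (S - T) w" by (simp add: mult.assoc)
  qed
  finally have "cycle_sum (insert a S) w = w {a} * cycle_sum S w +
      (\<Sum>T\<in>Pow S - {{}}. of_nat (fact (card T)) * w (insert a T) * cycle_sum (S - T) w)"
    using less.prems by (simp add: cycle_sum_insert_merge)
  also have "\<dots> = (\<Sum>T\<in>Pow S. of_nat (fact (card T)) * w (insert a T) * cycle_sum (S - T) w)"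
    using fin by (subst sum.remove[of "Pow S" "{}"]) auto
  finally show ?case .
qed

text \<open>Relabelling invariance. By induction from the recursion on the cycle of a chosen element, which
  mentions subsets only, instead of conjugating permutations.\<close>
lemma cycle_sum_image:
  assumes "finite S" "inj_on h S"
  shows "cycle_sum (h ` S) w = cycle_sum S (\<lambda>c. w (h ` c))"
  using assms
proof (induction "card S" arbitrary: S rule: less_induct)
  case less
  show ?case
  proof (cases "S = {}")
    case False
    then obtain a where a: "a \<in> S" by auto
    define R where "R = S - {a}"
    have S: "S = insert a R" "a \<notin> R" "finite R" using a less.prems by (auto simp: R_def)
    have inj: "inj_on h R" "h a \<notin> h ` R" using less.prems S by auto
    have "cycle_sum (h ` S) w = (\<Sum>T\<in>Pow (h ` R). of_nat (fact (card T)) * w (insert (h a) T) * cycle_sum (h ` R - T) w)"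
      unfolding S image_insert using S inj by (intro cycle_sum_insert) auto
    also have "Pow (h ` R) = (\<lambda>T. h ` T) ` Pow R" by (rule image_Pow_surj[OF refl, symmetric])
    also have "(\<Sum>T\<in>(\<lambda>T. h ` T) ` Pow R. of_nat (fact (card T)) * w (insert (h a) T) * cycle_sum (h ` R - T) w) =
        (\<Sum>T\<in>Pow R. of_nat (fact (card (h ` T))) * w (insert (h a) (h ` T)) * cycle_sum (h ` R - h ` T) w)"
      using inj by (subst sum.reindex) (auto intro: inj_on_image_Pow)
    also have "\<dots> = (\<Sum>T\<in>Pow R. of_nat (fact (card T)) * w (h ` insert a T) * cycle_sum (R - T) (\<lambda>c. w (h ` c)))"
    proof (intro sum.cong refl)
      fix T assume "T \<in> Pow R"
      then have T: "T \<subseteq> R" by simp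
      have "h ` R - h ` T = h ` (R - T)" using inj T by (auto simp: inj_on_def)
      moreover have "cycle_sum (h ` (R - T)) w = cycle_sum (R - T) (\<lambda>c. w (h ` c))"
        using less.prems S card_mono[of R "R - T"]
        by (intro less.hyps) (auto simp: inj_on_def)
      moreover have "card (h ` T) = card T"
        using inj T by (intro card_image) (auto intro: inj_on_subset)
      ultimately show "of_nat (fact (card (h ` T))) * w (insert (h a) (h ` T)) * cycle_sum (h ` R - h ` T) w =
        of_nat (fact (card T)) * w (h ` insert a T) * cycle_sum (R - T) (\<lambda>c. w (h ` c))" by simp
    qed
    also have "\<dots> = cycle_sum S (\<lambda>c. w (h ` c))"
      unfolding S using S by (simp add: cycle_sum_insert)
    finally show ?thesis .
  qed simp
qed

section \<open>The cycle index and the exponential formula\<close>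

lemma sum_Pow_card:
  fixes g :: "nat \<Rightarrow> 'c::comm_semiring_1"
  assumes "finite S"
  shows "(\<Sum>T\<in>Pow S. g (card T)) = (\<Sum>j\<le>card S. of_nat (card S choose j) * g j)"
proof -
  have "(\<Sum>T\<in>Pow S. g (card T)) = (\<Sum>j\<le>card S. \<Sum>T | T \<in> Pow S \<and> card T = j. g (card T))"
    using assms by (intro sum.group [symmetric]) (auto intro: card_mono)
  also have "\<dots> = (\<Sum>j\<le>card S. of_nat (card S choose j) * g j)"
    using n_subsets[OF assms] by (intro sum.cong refl) simp
  finally show ?thesis .
qed

lemma cycle_sum_card:
  assumes "finite S"
  shows "cycle_sum S (\<lambda>T. c (card T)) = cycle_sum {1..card S} (\<lambda>T. c (card T))"
proof -
  obtain h where h: "bij_betw h {1..card S} S"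
    using ex_bij_betw_nat_finite_1[OF assms] by blast
  then have inj: "inj_on h {1..card S}" and im: "h ` {1..card S} = S"
    by (auto simp: bij_betw_def)
  have "cycle_sum S (\<lambda>T. c (card T)) = cycle_sum {1..card S} (\<lambda>T. c (card (h ` T)))"
    using cycle_sum_image[OF _ inj, of "\<lambda>T. c (card T)"] im by simp
  also have "\<dots> = cycle_sum {1..card S} (\<lambda>T. c (card T))"
    by (intro cycle_sum_cong) (metis card_image inj inj_on_subset)
  finally show ?thesis .
qed

text \<open>The cycle index of the symmetric group on \<open>n\<close> letters, with \<open>c j\<close> substituted for the power sum
  \<open>p\<^sub>j\<close>; equivalently the complete homogeneous symmetric function \<open>h\<^sub>n\<close>.\<close>
definition cycle_index :: "(nat \<Rightarrow> real fps) \<Rightarrow> nat \<Rightarrow> real fps" where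
  "cycle_index c n = fps_const (1 / fact n) * cycle_sum {1..n} (\<lambda>T. c (card T))"

lemma cycle_index_0 [simp]: "cycle_index c 0 = 1"
  by (simp add: cycle_index_def)

text \<open>Newton's identity for the complete homogeneous symmetric functions. There are
  \<open>(m choose j) * j!\<close> cycles of length \<open>j + 1\<close> through a given one of \<open>n = m + 1\<close> letters, and this number
  is \<open>m!\<close> divided by the factorial of the number \<open>m - j\<close> of remaining letters.\<close>
lemma cycle_index_recurrence:
  "fps_const (real n) * cycle_index c n = (\<Sum>j<n. c (Suc j) * cycle_index c (n - Suc j))"
proof (cases n)
  case (Suc m)
  let ?q = "\<lambda>n. cycle_sum {1..n} (\<lambda>T. c (card T))"
  have "?q n = cycle_sum (insert (Suc m) {1..m}) (\<lambda>T. c (card T))"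
    using Suc by (simp add: atLeastAtMostSuc_conv)
  also have "\<dots> = (\<Sum>T\<in>Pow {1..m}. of_nat (fact (card T)) * c (card (insert (Suc m) T)) *
      cycle_sum ({1..m} - T) (\<lambda>T. c (card T)))"
    by (intro cycle_sum_insert) auto
  also have "\<dots> = (\<Sum>T\<in>Pow {1..m}. of_nat (fact (card T)) * c (Suc (card T)) * ?q (m - card T))"
  proof (intro sum.cong refl)
    fix T assume "T \<in> Pow {1..m}"
    then have T: "T \<subseteq> {1..m}" "finite T" using finite_subset by auto
    then have "card (insert (Suc m) T) = Suc (card T)" by (subst card_insert_disjoint) auto
    moreover have "card ({1..m} - T) = m - card T" using T by (simp add: card_Diff_subset)
    ultimately show "of_nat (fact (card T)) * c (card (insert (Suc m) T)) *
        cycle_sum ({1..m} - T) (\<lambda>T. c (card T)) = of_nat (fact (card T)) * c (Suc (card T)) * ?q (m - card T)"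
      using cycle_sum_card[of "{1..m} - T" c] by simp
  qed
  also have "\<dots> = (\<Sum>j\<le>m. of_nat (m choose j) * (of_nat (fact j) * c (Suc j) * ?q (m - j)))"
    using sum_Pow_card[of "{1..m}" "\<lambda>j. of_nat (fact j) * c (Suc j) * ?q (m - j)"] by simp
  finally have q: "?q n = (\<Sum>j\<le>m. of_nat (m choose j) * (of_nat (fact j) * c (Suc j) * ?q (m - j)))" .
  have "fps_const (real n) * cycle_index c n = fps_const (1 / fact m) * ?q n"
    using Suc by (simp add: cycle_index_def mult.assoc [symmetric] divide_simps)
  also have "\<dots> = (\<Sum>j\<le>m. c (Suc j) * cycle_index c (m - j))"
    unfolding q sum_distrib_left
  proof (intro sum.cong refl)
    fix j assume "j \<in> {..m}"
    then have "real (m choose j) * fact j * (1 / fact m) = 1 / fact (m - j)"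
      by (simp add: binomial_fact)
    then have "fps_const (1 / fact m) * (of_nat (m choose j) * of_nat (fact j)) = fps_const (1 / fact (m - j) :: real)"
      by (simp add: fps_of_nat [symmetric] mult.commute)
    then show "fps_const (1 / fact m) * (of_nat (m choose j) * (of_nat (fact j) * c (Suc j) * ?q (m - j))) =
      c (Suc j) * cycle_index c (m - j)"
      by (simp add: cycle_index_def mult_ac)
  qed
  also have "\<dots> = (\<Sum>j<n. c (Suc j) * cycle_index c (n - Suc j))"
    using Suc by (simp add: lessThan_Suc_atMost)
  finally show ?thesis .
qed simp

lemma sum_triangle_swap:
  fixes f :: "nat \<Rightarrow> nat \<Rightarrow> 'c::comm_monoid_add"
  shows "(\<Sum>j<n. \<Sum>i<n - Suc j. f i j) = (\<Sum>i<n. \<Sum>j<n - Suc i. f i j)"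
  unfolding sum.Sigma[OF finite_lessThan ballI[OF finite_lessThan]]
  by (rule sum.reindex_bij_witness[of _ "\<lambda>(i, j). (j, i)" "\<lambda>(i, j). (j, i)"]) auto

text \<open>With \<open>z\<^sub>n\<close> for \<open>cycle_index c n\<close>, this is the degree \<open>n\<close> part of \<open>Z' = H' Z\<close>, where \<open>H\<close> is the sum of
  all \<open>c j / j\<close> and \<open>Z\<close> the sum of all \<open>z\<^sub>n\<close>. Differentiate Newton's identity for \<open>n z\<^sub>n\<close>, insert the
  induction hypothesis, and use Newton's identity again for the inner sums: the terms with a given
  \<open>c j'\<close> get the factors \<open>j\<close> and \<open>n - j\<close>, which add up to \<open>n\<close>.\<close>
lemma deriv_cycle_index:
  "fps_deriv (cycle_index c n) =
   (\<Sum>j<n. fps_const (1 / real (Suc j)) * fps_deriv (c (Suc j)) * cycle_index c (n - Suc j))"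
proof (induction n rule: less_induct)
  case (less n)
  let ?z = "cycle_index c" and ?d = "\<lambda>j. fps_const (1 / real (Suc j)) * fps_deriv (c (Suc j))"
  show ?case
  proof (cases "n = 0")
    case False
    have d: "fps_deriv (c (Suc j)) = fps_const (real (Suc j)) * ?d j" for j
      by (simp add: mult.assoc [symmetric] del: of_nat_Suc)
    have "fps_const (real n) * fps_deriv (?z n) = fps_deriv (fps_const (real n) * ?z n)"
      by simp
    also have "\<dots> = (\<Sum>j<n. fps_deriv (c (Suc j)) * ?z (n - Suc j)) +
                    (\<Sum>j<n. c (Suc j) * fps_deriv (?z (n - Suc j)))"
      unfolding cycle_index_recurrence by (simp add: fps_deriv_sum sum.distrib algebra_simps)
    also have "(\<Sum>j<n. c (Suc j) * fps_deriv (?z (n - Suc j))) =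
        (\<Sum>j<n. \<Sum>i<n - Suc j. ?d i * (c (Suc j) * ?z (n - Suc j - Suc i)))"
      by (intro sum.cong refl, subst less.IH) (auto simp: sum_distrib_left mult_ac)
    also have "\<dots> = (\<Sum>i<n. \<Sum>j<n - Suc i. ?d i * (c (Suc j) * ?z (n - Suc j - Suc i)))"
      by (rule sum_triangle_swap)
    also have "\<dots> = (\<Sum>i<n. ?d i * (fps_const (real (n - Suc i)) * ?z (n - Suc i)))"
      by (simp only: cycle_index_recurrence sum_distrib_left diff_diff_left add.commute)
    also have "(\<Sum>j<n. fps_deriv (c (Suc j)) * ?z (n - Suc j)) + \<dots> =
        (\<Sum>j<n. fps_const (real n) * (?d j * ?z (n - Suc j)))"
      unfolding sum.distrib [symmetric]
    proof (intro sum.cong refl)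
      fix j assume "j \<in> {..<n}"
      then have "real n = real (Suc j) + real (n - Suc j)" by simp
      then have n: "fps_const (real n) = fps_const (real (Suc j)) + fps_const (real (n - Suc j))"
        by (simp only: fps_const_add)
      show "fps_deriv (c (Suc j)) * ?z (n - Suc j) + ?d j * (fps_const (real (n - Suc j)) * ?z (n - Suc j)) =
        fps_const (real n) * (?d j * ?z (n - Suc j))"
        unfolding n by (subst d) (simp only: algebra_simps)
    qed
    finally have "fps_const (real n) * fps_deriv (?z n) = fps_const (real n) * (\<Sum>j<n. ?d j * ?z (n - Suc j))"
      by (simp only: sum_distrib_left)
    then show ?thesis using False by simp
  qed simp
qed

lemma cycle_index_nth_eq_0:
  assumes "\<And>j l. l < j \<Longrightarrow> fps_nth (c j) l = 0"
  shows "l < n \<Longrightarrow> fps_nth (cycle_index c n) l = 0"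
proof (induction n arbitrary: l rule: less_induct)
  case (less n)
  have "real n * fps_nth (cycle_index c n) l = fps_nth (fps_const (real n) * cycle_index c n) l"
    by simp
  also have "\<dots> = (\<Sum>j<n. \<Sum>i=0..l. fps_nth (c (Suc j)) i * fps_nth (cycle_index c (n - Suc j)) (l - i))"
    unfolding cycle_index_recurrence by (simp add: fps_sum_nth fps_mult_nth)
  also have "\<dots> = 0"
  proof (intro sum.neutral ballI)
    fix j i assume "j \<in> {..<n}" "i \<in> {0..l}"
    then have "i < Suc j \<or> (n - Suc j < n \<and> l - i < n - Suc j)" using less.prems by auto
    then show "fps_nth (c (Suc j)) i * fps_nth (cycle_index c (n - Suc j)) (l - i) = 0"
      using assms less.IH by auto
  qed
  finally show ?case using less.prems by simp
qed

text \<open>The exponential formula \<open>exp (\<Sum>j. c j / j) = (\<Sum>n. z\<^sub>n)\<close>. The order condition on \<open>c\<close> makes both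
  sums finite in each degree. Both sides satisfy \<open>Z' = H' Z\<close> with constant coefficient \<open>1\<close>, so their
  coefficients obey the same recursion. Only the coefficients up to \<open>K\<close> enter, which allows \<open>c\<close> to
  come from a truncated series.\<close>
lemma exp_compose_eq_sum_cycle_index:
  assumes c: "\<And>j l. l < j \<Longrightarrow> fps_nth (c j) l = 0"
    and H0: "fps_nth H 0 = 0"
    and H: "\<And>l. 1 \<le> l \<Longrightarrow> l \<le> K \<Longrightarrow> fps_nth H l = (\<Sum>j=1..l. fps_nth (c j) l / real j)"
  shows "k \<le> K \<Longrightarrow> fps_nth (fps_exp 1 oo H) k = (\<Sum>n\<le>k. fps_nth (cycle_index c n) k)"
proof (induction k rule: less_induct)
  case (less k)
  let ?z = "cycle_index c" and ?G = "fps_exp 1 oo H"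
  let ?d = "\<lambda>j. fps_const (1 / real (Suc j)) * fps_deriv (c (Suc j))"
  have z0: "fps_nth (?z n) l = 0" if "l < n" for n l
    using cycle_index_nth_eq_0[OF c that] by simp
  show ?case
  proof (cases k)
    case 0
    then show ?thesis by simp
  next
    case (Suc m)
    have d0: "fps_nth (?d j) l = 0" if "l < j" for j l
      using that c by simp
    have dz0: "fps_nth (?d j * ?z i) m = 0" if "m < i + j" for i j
    proof (subst fps_mult_nth, intro sum.neutral ballI)
      fix l assume "l \<in> {0..m}"
      then have "l < j \<or> m - l < i" using that by auto
      then show "fps_nth (?d j) l * fps_nth (?z i) (m - l) = 0" using d0 z0 by (metis mult_eq_0_iff)
    qed
    have H': "fps_nth (fps_deriv H) l = fps_nth (\<Sum>j\<le>m. ?d j) l" if "l \<le> m" for l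
    proof -
      have "fps_nth (fps_deriv H) l = real (Suc l) * (\<Sum>j=1..Suc l. fps_nth (c j) (Suc l) / real j)"
        using that less.prems Suc by (simp add: H del: of_nat_Suc sum.cl_ivl_Suc)
      also have "\<dots> = (\<Sum>j=1..Suc l. real (Suc l) * (fps_nth (c j) (Suc l) / real j))"
        by (rule sum_distrib_left)
      also have "\<dots> = (\<Sum>j\<le>l. fps_nth (?d j) l)"
        by (rule sum.reindex_bij_witness[of _ Suc "\<lambda>j. j - 1"]) (auto simp del: of_nat_Suc)
      also have "\<dots> = (\<Sum>j\<le>m. fps_nth (?d j) l)"
        using that d0 by (intro sum.mono_neutral_left) auto
      finally show ?thesis by (simp add: fps_sum_nth)
    qed
    have G: "fps_nth ?G l = fps_nth (\<Sum>i\<le>m. ?z i) l" if "l \<le> m" for l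
    proof -
      have "fps_nth ?G l = (\<Sum>i\<le>l. fps_nth (?z i) l)"
        using that less.prems Suc by (intro less.IH) auto
      also have "\<dots> = (\<Sum>i\<le>m. fps_nth (?z i) l)"
        using that z0 by (intro sum.mono_neutral_left) auto
      finally show ?thesis by (simp add: fps_sum_nth)
    qed
    \<comment> \<open>Up to degree \<open>m\<close>, all series can be replaced by finite sums over \<open>j, i \<le> m\<close>.\<close>
    have "fps_deriv ?G = fps_deriv H * ?G"
      using H0 by (simp add: fps_compose_deriv mult.commute)
    then have "real k * fps_nth ?G k = fps_nth (fps_deriv H * ?G) m"
      using Suc by (metis fps_deriv_nth Suc_eq_plus1)
    also have "\<dots> = fps_nth ((\<Sum>j\<le>m. ?d j) * (\<Sum>i\<le>m. ?z i)) m"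
      unfolding fps_mult_nth by (intro sum.cong refl) (use H' G in auto)
    also have "\<dots> = (\<Sum>j\<le>m. \<Sum>i\<le>m. fps_nth (?d j * ?z i) m)"
      by (simp only: sum_product fps_sum_nth)
    also have "\<dots> = (\<Sum>(j, i)\<in>{..m} \<times> {..m}. fps_nth (?d j * ?z i) m)"
      by (rule sum.cartesian_product)
    also have "\<dots> = (\<Sum>(j, i)\<in>{(j, i). i + j \<le> m}. fps_nth (?d j * ?z i) m)"
      using dz0 by (intro sum.mono_neutral_right) (auto, meson not_le)
    also have "\<dots> = (\<Sum>(n, j)\<in>Sigma {..k} (\<lambda>n. {..<n}). fps_nth (?d j * ?z (n - Suc j)) m)"
      using Suc by (intro sum.reindex_bij_witness[of _ "\<lambda>(n, j). (j, n - Suc j)" "\<lambda>(j, i). (Suc (i + j), j)"]) auto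
    also have "\<dots> = (\<Sum>n\<le>k. \<Sum>j<n. fps_nth (?d j * ?z (n - Suc j)) m)"
      by (subst sum.Sigma) auto
    also have "\<dots> = (\<Sum>n\<le>k. fps_nth (fps_deriv (?z n)) m)"
      by (simp only: deriv_cycle_index fps_sum_nth)
    also have "\<dots> = real k * (\<Sum>n\<le>k. fps_nth (?z n) k)"
      using Suc by (simp add: sum_distrib_left del: of_nat_Suc sum.atMost_Suc)
    finally show ?thesis using Suc by simp
  qed
qed

section \<open>Multilinear expansion over blocks\<close>

lemma sum_PiE_Un:
  fixes h k :: "('b \<Rightarrow> 'd) \<Rightarrow> 'c::comm_semiring_0"
  assumes "A \<inter> B = {}"
  shows "(\<Sum>e\<in>A \<rightarrow>\<^sub>E K. h e) * (\<Sum>e\<in>B \<rightarrow>\<^sub>E K. k e) =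
         (\<Sum>e\<in>A \<union> B \<rightarrow>\<^sub>E K. h (restrict e A) * k (restrict e B))"
proof -
  let ?glue = "\<lambda>p x. if x \<in> A then fst p x else snd p x"
  let ?split = "\<lambda>e. (restrict e A, restrict e B)"
  have split_glue: "?split (?glue p) = p" and glue_in: "?glue p \<in> A \<union> B \<rightarrow>\<^sub>E K"
    if p: "p \<in> (A \<rightarrow>\<^sub>E K) \<times> (B \<rightarrow>\<^sub>E K)" for p
  proof -
    obtain e e' where e: "p = (e, e')" "e \<in> A \<rightarrow>\<^sub>E K" "e' \<in> B \<rightarrow>\<^sub>E K" using p by blast
    have "restrict (?glue p) A = restrict e A" by (auto simp: e(1))
    moreover have "restrict (?glue p) B = restrict e' B" using assms by (auto simp: e(1) fun_eq_iff)
    ultimately show "?split (?glue p) = p" using e by (simp add: PiE_restrict)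
    show "?glue p \<in> A \<union> B \<rightarrow>\<^sub>E K"
    proof (rule PiE_I)
      fix x assume "x \<in> A \<union> B"
      then show "?glue p x \<in> K" using e by (auto dest: PiE_mem)
    next
      fix x assume "x \<notin> A \<union> B"
      then show "?glue p x = undefined" using PiE_arb[OF e(3)] by (simp add: e(1))
    qed
  qed
  have glue_split: "?glue (?split e) = e" and split_in: "?split e \<in> (A \<rightarrow>\<^sub>E K) \<times> (B \<rightarrow>\<^sub>E K)"
    if e: "e \<in> A \<union> B \<rightarrow>\<^sub>E K" for e
  proof -
    have "?glue (?split e) x = e x" for x using PiE_arb[OF e, of x] by simp
    then show "?glue (?split e) = e" by (rule ext)
    show "?split e \<in> (A \<rightarrow>\<^sub>E K) \<times> (B \<rightarrow>\<^sub>E K)"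
      using e by (auto dest: PiE_mem)
  qed
  have "(\<Sum>e\<in>A \<rightarrow>\<^sub>E K. h e) * (\<Sum>e\<in>B \<rightarrow>\<^sub>E K. k e) =
        (\<Sum>p\<in>(A \<rightarrow>\<^sub>E K) \<times> (B \<rightarrow>\<^sub>E K). h (fst p) * k (snd p))"
    unfolding sum_product sum.cartesian_product by (simp only: split_def)
  also have "\<dots> = (\<Sum>e\<in>A \<union> B \<rightarrow>\<^sub>E K. h (restrict e A) * k (restrict e B))"
  proof (rule sum.reindex_bij_witness[of _ ?split ?glue])
    fix p assume p: "p \<in> (A \<rightarrow>\<^sub>E K) \<times> (B \<rightarrow>\<^sub>E K)"
    show eq: "?split (?glue p) = p" by (rule split_glue[OF p])
    show "h (restrict (?glue p) A) * k (restrict (?glue p) B) = h (fst p) * k (snd p)"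
      using arg_cong[OF eq, of fst] arg_cong[OF eq, of snd] by (simp only: fst_conv snd_conv)
    show "?glue p \<in> A \<union> B \<rightarrow>\<^sub>E K" by (rule glue_in[OF p])
  qed (fact glue_split, fact split_in)
  finally show ?thesis .
qed

lemma prod_sum_PiE_Union:
  fixes g :: "'b set \<Rightarrow> ('b \<Rightarrow> 'd) \<Rightarrow> 'c::comm_semiring_1"
  assumes "finite C" "pairwise disjnt C" and g: "\<And>c e. g c (restrict e c) = g c e"
  shows "(\<Prod>c\<in>C. \<Sum>e\<in>c \<rightarrow>\<^sub>E K. g c e) = (\<Sum>e\<in>\<Union>C \<rightarrow>\<^sub>E K. \<Prod>c\<in>C. g c e)"
  using assms(1,2)
proof (induction C rule: finite_induct)
  case (insert c C)
  have disj: "c \<inter> \<Union>C = {}"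
    using insert.prems insert.hyps(2) by (auto simp: pairwise_insert disjnt_iff)
  have "(\<Prod>c\<in>insert c C. \<Sum>e\<in>c \<rightarrow>\<^sub>E K. g c e) =
        (\<Sum>e\<in>c \<rightarrow>\<^sub>E K. g c e) * (\<Sum>e\<in>\<Union>C \<rightarrow>\<^sub>E K. \<Prod>c\<in>C. g c e)"
    using insert by (simp add: pairwise_insert)
  also have "\<dots> = (\<Sum>e\<in>c \<union> \<Union>C \<rightarrow>\<^sub>E K. g c (restrict e c) * (\<Prod>c\<in>C. g c (restrict e (\<Union>C))))"
    by (rule sum_PiE_Un[OF disj])
  also have "\<dots> = (\<Sum>e\<in>c \<union> \<Union>C \<rightarrow>\<^sub>E K. g c e * (\<Prod>c\<in>C. g c e))"
  proof -
    have "g c' (restrict e (\<Union>C)) = g c' e" if "c' \<in> C" for c' e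
    proof -
      have "\<Union>C \<inter> c' = c'" using that by auto
      then show ?thesis
        using g[of c' "restrict e (\<Union>C)"] g[of c' e] by simp
    qed
    then show ?thesis by (simp add: g)
  qed
  finally show ?case using insert.hyps by simp
qed simp

lemma orbits_partition:
  assumes "finite S" "\<sigma> permutes S"
  shows "pairwise disjnt (orbit \<sigma> ` S)" "\<Union>(orbit \<sigma> ` S) = S"
proof -
  have perm: "permutation \<sigma>" using assms permutation_permutes by blast
  show "pairwise disjnt (orbit \<sigma> ` S)"
  proof (rule pairwiseI, rule ccontr)
    fix c d assume c: "c \<in> orbit \<sigma> ` S" "d \<in> orbit \<sigma> ` S" "c \<noteq> d" "\<not> disjnt c d"
    then obtain x where "x \<in> c" "x \<in> d" by (auto simp: disjnt_iff)
    moreover have "cyclic_on \<sigma> c" "cyclic_on \<sigma> d" using c(1,2) cyclic_on_orbit'[OF perm] by auto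
    ultimately show False using c(3) orbit_cyclic_eq3[of \<sigma> c x] orbit_cyclic_eq3[of \<sigma> d x] by simp
  qed
  show "\<Union>(orbit \<sigma> ` S) = S"
    using permutes_orbit_subset[OF assms(2)] permutation_self_in_orbit[OF perm] by blast
qed

text \<open>The cycles of a permutation partition \<open>S\<close>, so choosing an assignment on every cycle is the same as
  choosing one on \<open>S\<close>. This is the multilinearity that lets the moments of a series be expanded
  coefficientwise inside a cycle sum.\<close>
lemma cycle_sum_sum_PiE:
  fixes g :: "'b set \<Rightarrow> ('b \<Rightarrow> 'd) \<Rightarrow> 'c::comm_ring_1"
  assumes "finite S" and g: "\<And>c e. g c (restrict e c) = g c e"
  shows "cycle_sum S (\<lambda>c. \<Sum>e\<in>c \<rightarrow>\<^sub>E K. g c e) = (\<Sum>e\<in>S \<rightarrow>\<^sub>E K. cycle_sum S (\<lambda>c. g c e))"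
proof -
  have "(\<Prod>c\<in>orbit \<sigma> ` S. \<Sum>e\<in>c \<rightarrow>\<^sub>E K. g c e) = (\<Sum>e\<in>S \<rightarrow>\<^sub>E K. \<Prod>c\<in>orbit \<sigma> ` S. g c e)"
    if "\<sigma> permutes S" for \<sigma>
    using prod_sum_PiE_Union[where g = g and K = K, OF finite_imageI[OF assms(1)] orbits_partition(1)[OF assms(1) that] g]
      orbits_partition(2)[OF assms(1) that] by simp
  then have "cycle_sum S (\<lambda>c. \<Sum>e\<in>c \<rightarrow>\<^sub>E K. g c e) =
      (\<Sum>\<sigma> | \<sigma> permutes S. \<Sum>e\<in>S \<rightarrow>\<^sub>E K. \<Prod>c\<in>orbit \<sigma> ` S. g c e)"
    by (simp add: cycle_sum_def)
  also have "\<dots> = (\<Sum>e\<in>S \<rightarrow>\<^sub>E K. cycle_sum S (\<lambda>c. g c e))"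
    unfolding cycle_sum_def by (rule sum.swap)
  finally show ?thesis .
qed

lemma fps_const_sum_distrib: "fps_const (\<Sum>x\<in>A. v x) = (\<Sum>x\<in>A. fps_const (v x))"
  by (induction A rule: infinite_finite_induct) (simp_all flip: fps_const_add)

lemma fps_const_prod_distrib:
  "fps_const (\<Prod>x\<in>A. v x) = (\<Prod>x\<in>A. fps_const (v x :: 'c::comm_ring_1))"
  by (induction A rule: infinite_finite_induct) (simp_all flip: fps_const_mult)

lemma prod_monomials:
  "(\<Prod>x\<in>A. fps_const (v x) * fps_X ^ d x) = fps_const (\<Prod>x\<in>A. v x :: 'c::comm_ring_1) * fps_X ^ (\<Sum>x\<in>A. d x)"
  by (simp add: prod.distrib fps_const_prod_distrib power_sum)

lemma cycle_sum_monomials: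
  assumes "finite S"
  shows "cycle_sum S (\<lambda>c. fps_const (v c) * fps_X ^ (\<Sum>i\<in>c. e i)) =
         fps_const (cycle_sum S v) * fps_X ^ (\<Sum>i\<in>S. e i)"
proof -
  have "(\<Sum>c\<in>orbit \<sigma> ` S. \<Sum>i\<in>c. e i) = (\<Sum>i\<in>S. e i)" if "\<sigma> permutes S" for \<sigma>
  proof -
    have fin: "\<forall>c\<in>orbit \<sigma> ` S. finite c"
      using permutes_orbit_subset[OF that] assms by (auto intro: finite_subset)
    have "(\<Sum>i\<in>\<Union>(orbit \<sigma> ` S). e i) = (\<Sum>c\<in>orbit \<sigma> ` S. \<Sum>i\<in>c. e i)"
      using orbits_partition(1)[OF assms that]
      by (intro sum.Union_disjoint[unfolded o_def] fin) (auto simp: pairwise_def disjnt_def)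
    then show ?thesis using orbits_partition(2)[OF assms that] by simp
  qed
  then show ?thesis
    by (simp add: cycle_sum_def prod_monomials fps_const_sum_distrib sum_distrib_right)
qed

section \<open>Coefficients of the positivity series\<close>

text \<open>The sign is absorbed by negating the weight of every cycle; the truncated exponent of \<open>-1\<close> makes
  \<open>n \<ge> 1\<close> necessary.\<close>
lemma E_n_eq_cycle_sum:
  assumes "n \<ge> 1"
  shows "E_n M n f = - cycle_sum {1..n} (\<lambda>c. - (\<integral>x. (\<Prod>i\<in>c. f i x) \<partial>M))"
proof -
  have "(- 1) ^ (card (cycle_sets n \<sigma>) - 1) * E_perm M n \<sigma> f =
        - (\<Prod>c\<in>orbit \<sigma> ` {1..n}. - (\<integral>x. (\<Prod>i\<in>c. f i x) \<partial>M))" for \<sigma>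
  proof -
    have "card (cycle_sets n \<sigma>) > 0" using assms by (auto simp: cycle_sets_def card_gt_0_iff)
    then obtain m where "card (cycle_sets n \<sigma>) = Suc m" using gr0_implies_Suc by blast
    then show ?thesis by (simp add: prod_uminus E_perm_def cycle_sets_def)
  qed
  then show ?thesis by (simp add: E_n_def cycle_sum_def sum_negf)
qed

text \<open>The truncation of the generating series at degree \<open>K\<close>: its powers are finite sums over
  assignments of exponents, to which expectation and the expansion over blocks apply.\<close>
definition gen_poly :: "(nat \<Rightarrow> 'a \<Rightarrow> real) \<Rightarrow> nat \<Rightarrow> 'a \<Rightarrow> real fps" where
  "gen_poly f K x = (\<Sum>i=1..K. fps_const (f i x) * fps_X ^ i)"

lemma gen_poly_power:
  assumes "finite T"
  shows "gen_poly f K x ^ card T =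
    (\<Sum>e\<in>T \<rightarrow>\<^sub>E {1..K}. fps_const (\<Prod>i\<in>T. f (e i) x) * fps_X ^ (\<Sum>i\<in>T. e i))"
proof -
  have "gen_poly f K x ^ card T = (\<Prod>s\<in>T. \<Sum>i\<in>{1..K}. fps_const (f i x) * fps_X ^ i)"
    by (simp add: gen_poly_def)
  also have "\<dots> = (\<Sum>e\<in>T \<rightarrow>\<^sub>E {1..K}. \<Prod>s\<in>T. fps_const (f (e s) x) * fps_X ^ e s)"
    using assms by (intro prod_sum_PiE) auto
  finally show ?thesis by (simp only: prod_monomials)
qed

lemma fps_power_nth_cong:
  fixes F G :: "'c::comm_ring_1 fps"
  assumes "\<And>l. l \<le> K \<Longrightarrow> fps_nth F l = fps_nth G l"
  shows "l \<le> K \<Longrightarrow> fps_nth (F ^ j) l = fps_nth (G ^ j) l"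
proof (induction j arbitrary: l)
  case (Suc j)
  then show ?case using assms by (auto simp: fps_mult_nth intro!: sum.cong)
qed simp

lemma gen_series_power_nth:
  assumes "l \<le> K"
  shows "fps_nth (gen_series f x ^ j) l = fps_nth (gen_poly f K x ^ j) l"
proof (rule fps_power_nth_cong[OF _ assms])
  fix l assume "l \<le> K"
  then show "fps_nth (gen_series f x) l = fps_nth (gen_poly f K x) l"
    by (auto simp: gen_series_def gen_poly_def fps_sum_nth if_distrib sum.delta cong: if_cong)
qed

lemma integrable_prod_reindex:
  fixes f :: "nat \<Rightarrow> 'a \<Rightarrow> real" and T :: "'b set"
  assumes int: "\<And>(n::nat) e. (\<forall>i\<in>{1..n}. e i \<ge> 1) \<Longrightarrow> integrable M (\<lambda>x. \<Prod>i\<in>{1..n}. f (e i) x)"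
    and "finite T" "\<forall>i\<in>T. e i \<ge> 1"
  shows "integrable M (\<lambda>x. \<Prod>i\<in>T. f (e i) x)"
proof -
  obtain h where h: "bij_betw h {1..card T} T"
    using ex_bij_betw_nat_finite_1[OF assms(2)] by blast
  have "integrable M (\<lambda>x. \<Prod>i\<in>{1..card T}. f (e (h i)) x)"
    using h assms(3) by (intro int) (auto simp: bij_betw_def)
  moreover have "(\<Prod>i\<in>{1..card T}. f (e (h i)) x) = (\<Prod>i\<in>T. f (e i) x)" for x
    by (rule prod.reindex_bij_betw[OF h])
  ultimately show ?thesis by simp
qed

context
  fixes M :: "'a measure" and f :: "nat \<Rightarrow> 'a \<Rightarrow> real"
  assumes int: "\<And>(n::nat) e. (\<forall>i\<in>{1..n}. e i \<ge> 1) \<Longrightarrow> integrable M (\<lambda>x. \<Prod>i\<in>{1..n}. f (e i) x)"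
begin

lemma integrable_gen_poly_power:
  "integrable M (\<lambda>x. fps_nth (gen_poly f K x ^ j) l)"
proof -
  have "integrable M (\<lambda>x. fps_nth (gen_poly f K x ^ card {1..j}) l)"
    unfolding gen_poly_power[OF finite_atLeastAtMost] fps_sum_nth
    by (intro Bochner_Integration.integrable_sum) 
       (auto intro!: integrable_prod_reindex[OF int])
  then show ?thesis by simp
qed

lemma expectation_gen_poly_power:
  assumes "finite T"
  shows "fps_expectation M (\<lambda>x. gen_poly f K x ^ card T) =
    (\<Sum>e\<in>T \<rightarrow>\<^sub>E {1..K}. fps_const (\<integral>x. (\<Prod>i\<in>T. f (e i) x) \<partial>M) * fps_X ^ (\<Sum>i\<in>T. e i))"
proof (rule fps_ext)
  fix l
  have "integrable M (\<lambda>x. if l = (\<Sum>i\<in>T. e i) then (\<Prod>i\<in>T. f (e i) x) else 0)"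
    if "e \<in> T \<rightarrow>\<^sub>E {1..K}" for e
  proof (cases "l = (\<Sum>i\<in>T. e i)")
    case True
    then show ?thesis using that assms by (simp, intro integrable_prod_reindex[OF int]) auto
  qed simp
  then have "(\<integral>x. (\<Sum>e\<in>T \<rightarrow>\<^sub>E {1..K}. if l = (\<Sum>i\<in>T. e i) then (\<Prod>i\<in>T. f (e i) x) else 0) \<partial>M) =
    (\<Sum>e\<in>T \<rightarrow>\<^sub>E {1..K}. \<integral>x. (if l = (\<Sum>i\<in>T. e i) then (\<Prod>i\<in>T. f (e i) x) else 0) \<partial>M)"
    by (intro Bochner_Integration.integral_sum) auto
  then show "fps_nth (fps_expectation M (\<lambda>x. gen_poly f K x ^ card T)) l =
    fps_nth (\<Sum>e\<in>T \<rightarrow>\<^sub>E {1..K}. fps_const (\<integral>x. (\<Prod>i\<in>T. f (e i) x) \<partial>M) * fps_X ^ (\<Sum>i\<in>T. e i)) l"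
    by (auto simp: fps_expectation_def gen_poly_power[OF assms] fps_sum_nth if_distrib intro!: sum.cong cong: if_cong)
qed

text \<open>With \<open>A\<close> for the generating series, the expectation of \<open>log (1 - A)\<close> is \<open>\<Sum>j. c j / j\<close>, where
  \<open>c j\<close> is minus the expectation of \<open>A ^ j\<close>. By the exponential formula the exponential is
  the sum of the cycle indices, and expanding every \<open>c j\<close> over assignments \<open>e\<close> of exponents turns
  the \<open>n\<close>-th one into the sum of the \<open>- E_n\<close> of the \<open>f (e i)\<close>, divided by \<open>n!\<close>. The coefficient of
  degree \<open>k\<close> only involves exponents up to \<open>k\<close>, hence the truncation there.\<close>
lemma positivity_series_nth:
  assumes "k \<ge> 1"
  shows "fps_nth (positivity_series M f) k =
    (\<Sum>n=1..k. (\<Sum>e | e \<in> {1..n} \<rightarrow>\<^sub>E {1..k} \<and> (\<Sum>i=1..n. e i) = k. E_n M n (\<lambda>i. f (e i))) / fact n)"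
proof -
  define c where "c j = - fps_expectation M (\<lambda>x. gen_poly f k x ^ j)" for j
  define H where "H = fps_expectation M (\<lambda>x. fps_log (1 - gen_series f x))"
  have gen0: "fps_nth (gen_series f x) 0 = 0" for x by (simp add: gen_series_def)
  have Hnth: "fps_nth H l = (\<Sum>j=1..l. fps_nth (c j) l / real j)" if "l \<le> k" for l
  proof -
    have "fps_nth H l = (\<integral>x. - (\<Sum>j=1..l. fps_nth (gen_poly f k x ^ j) l / real j) \<partial>M)"
      unfolding H_def fps_expectation_def using that
      by (simp add: fps_log_one_minus_nth gen0 gen_series_power_nth)
    also have "\<dots> = - (\<Sum>j=1..l. (\<integral>x. fps_nth (gen_poly f k x ^ j) l \<partial>M) / real j)"
      using integrable_gen_poly_power by (simp add: Bochner_Integration.integral_sum)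
    finally show ?thesis by (simp add: c_def fps_expectation_def sum_negf)
  qed
  have cord: "fps_nth (c j) l = 0" if "l < j" for j l
  proof -
    have "fps_nth (gen_poly f k x ^ j) l = 0" for x
      using that by (intro startsby_zero_power_prefix[rule_format, of "gen_poly f k x"])
        (auto simp: gen_poly_def fps_sum_nth)
    then show ?thesis by (simp add: c_def fps_expectation_def)
  qed
  have coeff: "fps_nth (cycle_index c n) k =
      - (\<Sum>e | e \<in> {1..n} \<rightarrow>\<^sub>E {1..k} \<and> (\<Sum>i=1..n. e i) = k. E_n M n (\<lambda>i. f (e i))) / fact n"
    if "n \<ge> 1" for n
  proof -
    define v where "v e T = - (\<integral>x. (\<Prod>i\<in>T. f (e i) x) \<partial>M)" for e :: "nat \<Rightarrow> nat" and T
    have "cycle_sum {1..n} (\<lambda>T. c (card T)) =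
        cycle_sum {1..n} (\<lambda>T. \<Sum>e\<in>T \<rightarrow>\<^sub>E {1..k}. fps_const (v e T) * fps_X ^ (\<Sum>i\<in>T. e i))"
    proof (rule cycle_sum_cong)
      fix T assume "T \<subseteq> {1..n}"
      then have "finite T" by (rule finite_subset) simp
      then show "c (card T) = (\<Sum>e\<in>T \<rightarrow>\<^sub>E {1..k}. fps_const (v e T) * fps_X ^ (\<Sum>i\<in>T. e i))"
        by (simp add: c_def v_def expectation_gen_poly_power sum_negf flip: fps_const_neg)
    qed
    also have "\<dots> = (\<Sum>e\<in>{1..n} \<rightarrow>\<^sub>E {1..k}. cycle_sum {1..n} (\<lambda>T. fps_const (v e T) * fps_X ^ (\<Sum>i\<in>T. e i)))"
      by (intro cycle_sum_sum_PiE) (auto simp: v_def)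
    also have "\<dots> = (\<Sum>e\<in>{1..n} \<rightarrow>\<^sub>E {1..k}. fps_const (cycle_sum {1..n} (v e)) * fps_X ^ (\<Sum>i=1..n. e i))"
      by (simp add: cycle_sum_monomials)
    finally have "fps_nth (cycle_sum {1..n} (\<lambda>T. c (card T))) k =
        (\<Sum>e\<in>{1..n} \<rightarrow>\<^sub>E {1..k}. if (\<Sum>i=1..n. e i) = k then cycle_sum {1..n} (v e) else 0)"
      by (auto simp: fps_sum_nth intro!: sum.cong)
    also have "\<dots> = (\<Sum>e | e \<in> {1..n} \<rightarrow>\<^sub>E {1..k} \<and> (\<Sum>i=1..n. e i) = k. cycle_sum {1..n} (v e))"
      by (rule sum.inter_filter [symmetric]) (auto intro: finite_PiE)
    also have "\<dots> = - (\<Sum>e | e \<in> {1..n} \<rightarrow>\<^sub>E {1..k} \<and> (\<Sum>i=1..n. e i) = k. E_n M n (\<lambda>i. f (e i)))"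
      by (simp add: E_n_eq_cycle_sum[OF that] v_def [abs_def] sum_negf)
    finally show ?thesis by (simp add: cycle_index_def)
  qed
  have "fps_nth (fps_exp 1 oo H) k = (\<Sum>n\<le>k. fps_nth (cycle_index c n) k)"
    by (rule exp_compose_eq_sum_cycle_index[where K = k, OF cord _ Hnth]) (use Hnth[of 0] in auto)
  also have "\<dots> = (\<Sum>n=1..k. fps_nth (cycle_index c n) k)"
    using assms by (intro sum.mono_neutral_right) (auto simp: not_less_eq_eq)
  finally show ?thesis
    using assms by (simp add: positivity_series_def H_def coeff sum_negf)
qed

end

section \<open>Exponents with a unique sum\<close>

lemma base_digits_unique:
  fixes B :: nat
  assumes "(\<Sum>i<n. a i * B ^ i) = (\<Sum>i<n. b i * B ^ i)"
    and "\<And>i. i < n \<Longrightarrow> a i < B" "\<And>i. i < n \<Longrightarrow> b i < B"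
    and "i < n"
  shows "a i = b i"
  using assms
proof (induction n arbitrary: a b i)
  case (Suc n)
  have shift: "(\<Sum>i<Suc n. d i * B ^ i) = d 0 + B * (\<Sum>i<n. d (Suc i) * B ^ i)" for d
    unfolding sum.lessThan_Suc_shift by (simp add: sum_distrib_left mult_ac)
  have eq: "a 0 + B * (\<Sum>i<n. a (Suc i) * B ^ i) = b 0 + B * (\<Sum>i<n. b (Suc i) * B ^ i)"
    using Suc.prems(1) unfolding shift .
  have lt: "a 0 < B" "b 0 < B" using Suc.prems by auto
  have zero: "a 0 = b 0"
    using arg_cong[OF eq, of "\<lambda>x. x mod B"] lt by simp
  then have "(\<Sum>i<n. a (Suc i) * B ^ i) = (\<Sum>i<n. b (Suc i) * B ^ i)"
    using eq lt by simp
  then have "a (Suc j) = b (Suc j)" if "j < n" for j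
    using that Suc.prems by (intro Suc.IH[of "\<lambda>i. a (Suc i)" "\<lambda>i. b (Suc i)"]) auto
  then show ?case using zero Suc.prems(4) by (cases i) auto
qed simp

text \<open>These exponents isolate one multilinear term. In base \<open>n + 1\<close>, the digits of a sum of at
  most \<open>n\<close> of them count how often each occurs, and the coefficient of the leading power counts the
  summands. A sum equal to \<open>\<Sum>i=1..n. exponent n i\<close> cannot have more than \<open>n\<close> summands, by the size
  of that leading power, so its digits determine the summands.\<close>
definition exponent :: "nat \<Rightarrow> nat \<Rightarrow> nat" where
  "exponent n i = (n + 1) ^ (n + 1) + (n + 1) ^ i"

lemma sum_exponent_unique:
  assumes p: "p \<in> {1..m} \<rightarrow> {1..n}"
    and eq: "(\<Sum>i=1..m. exponent n (p i)) = (\<Sum>i=1..n. exponent n i)"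
  shows "m = n" "bij_betw p {1..n} {1..n}"
proof -
  let ?B = "n + 1"
  \<comment> \<open>The base \<open>n + 1\<close> digits of the two sums; position \<open>n + 1\<close> holds the number of summands, position 0 is empty.\<close>
  define a where "a v = (if v = n + 1 then m else card {i \<in> {1..m}. p i = v})" for v
  define b where "b v = (if v = n + 1 then n else if v = 0 then 0 else 1)" for v
  have sum_p: "(\<Sum>i=1..m. ?B ^ p i) = (\<Sum>v=1..n. card {i \<in> {1..m}. p i = v} * ?B ^ v)"
  proof -
    have "(\<Sum>v=1..n. card {i \<in> {1..m}. p i = v} * ?B ^ v) =
        (\<Sum>v=1..n. \<Sum>i | i \<in> {1..m} \<and> p i = v. ?B ^ p i)" by simp
    also have "\<dots> = (\<Sum>i=1..m. ?B ^ p i)"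
      using p by (intro sum.group) auto
    finally show ?thesis by simp
  qed
  have digits: "(\<Sum>v<n + 2. d v * ?B ^ v) = d (n + 1) * ?B ^ (n + 1) + (\<Sum>v=1..n. d v * ?B ^ v)"
    if "d 0 = 0" for d :: "nat \<Rightarrow> nat"
  proof -
    have "{..<n + 2} = insert (n + 1) (insert 0 {1..n})" by auto
    then show ?thesis using that by simp
  qed
  have "{i \<in> {1..m}. p i = 0} = {}" using p by force
  then have a0: "a 0 = 0" by (simp add: a_def)
  have sum_a: "(\<Sum>v<n + 2. a v * ?B ^ v) = (\<Sum>i=1..m. exponent n (p i))"
    unfolding digits[of a, OF a0] exponent_def sum.distrib sum_p by (simp add: a_def)
  have sum_b: "(\<Sum>v<n + 2. b v * ?B ^ v) = (\<Sum>i=1..n. exponent n i)"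
    by (subst digits) (auto simp: b_def exponent_def sum.distrib)
  have "m \<le> n"
  proof -
    have "(\<Sum>i=1..n. ?B ^ i) \<le> (\<Sum>i=1..n. ?B ^ n)" by (intro sum_mono power_increasing) auto
    also have "\<dots> < ?B ^ (n + 1)" by simp
    finally have "(\<Sum>i=1..n. exponent n i) < (n + 1) * ?B ^ (n + 1)"
      by (simp add: exponent_def sum.distrib)
    moreover have "m * ?B ^ (n + 1) \<le> (\<Sum>i=1..m. exponent n (p i))"
      by (simp add: exponent_def sum.distrib)
    ultimately have "m * ?B ^ (n + 1) < (n + 1) * ?B ^ (n + 1)" using eq by linarith
    then have "m < n + 1" by (simp only: mult_less_cancel2)
    then show ?thesis by simp
  qed
  have a_lt: "a v < ?B" for v
  proof -
    have "card {i \<in> {1..m}. p i = v} \<le> card {1..m}" by (intro card_mono) auto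
    then show ?thesis using \<open>m \<le> n\<close> by (simp add: a_def)
  qed
  have ab: "a v = b v" if "v < n + 2" for v
    by (rule base_digits_unique[of a ?B "n + 2" b]) (use that a_lt eq sum_a sum_b in \<open>auto simp: b_def\<close>)
  from ab[of "n + 1"] show mn: "m = n" by (simp add: a_def b_def)
  have "\<exists>i\<in>{1..n}. p i = v" if v: "v \<in> {1..n}" for v
  proof -
    have "card {i \<in> {1..m}. p i = v} = 1" using ab[of v] v by (auto simp: a_def b_def)
    then have "{i \<in> {1..m}. p i = v} \<noteq> {}" by (metis card.empty zero_neq_one)
    then show ?thesis using mn by auto
  qed
  then have "{1..n} \<subseteq> p ` {1..n}" by (blast intro: sym)
  moreover have "p ` {1..n} \<subseteq> {1..n}" using p mn by blast
  ultimately have "p ` {1..n} = {1..n}" by simp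
  then show "bij_betw p {1..n} {1..n}"
    by (simp add: bij_betw_def eq_card_imp_inj_on)
qed

section \<open>The equivalence\<close>

lemma E_n_permute:
  assumes "bij_betw p {1..n} {1..n}" "n \<ge> 1"
  shows "E_n M n (\<lambda>i. g (p i)) = E_n M n g"
proof -
  have inj: "inj_on p {1..n}" and im: "p ` {1..n} = {1..n}" using assms by (auto simp: bij_betw_def)
  have "cycle_sum {1..n} (\<lambda>c. - (\<integral>x. (\<Prod>i\<in>c. g (p i) x) \<partial>M)) =
        cycle_sum {1..n} (\<lambda>c. - (\<integral>x. (\<Prod>i\<in>p ` c. g i x) \<partial>M))"
    using inj by (intro cycle_sum_cong) (simp add: prod.reindex inj_on_subset)
  also have "\<dots> = cycle_sum (p ` {1..n}) (\<lambda>c. - (\<integral>x. (\<Prod>i\<in>c. g i x) \<partial>M))"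
    using inj by (simp add: cycle_sum_image)
  finally show ?thesis using im by (simp add: E_n_eq_cycle_sum[OF assms(2)])
qed

lemma E_n_zero:
  assumes "j \<in> {1..n}" "f j = (\<lambda>_. 0)"
  shows "E_n M n f = 0"
proof -
  have "E_perm M n \<sigma> f = 0" if \<sigma>: "\<sigma> permutes {1..n}" for \<sigma>
  proof -
    obtain c where c: "c \<in> cycle_sets n \<sigma>" "j \<in> c"
      using orbits_partition(2)[OF _ \<sigma>] assms(1) unfolding cycle_sets_def by blast
    have "c \<subseteq> {1..n}" using c permutes_orbit_subset[OF \<sigma>] unfolding cycle_sets_def by blast
    then have "finite c" by (rule finite_subset) simp
    then have "(\<Prod>i\<in>c. f i x) = 0" for x using c assms(2) by (intro prod_zero bexI[of _ j]) simp_all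
    then have "(\<integral>x. (\<Prod>i\<in>c. f i x) \<partial>M) = 0" by simp
    moreover have "finite (cycle_sets n \<sigma>)" by (simp add: cycle_sets_def)
    ultimately show ?thesis using c unfolding E_perm_def by (intro prod_zero) auto
  qed
  then show ?thesis by (simp add: E_n_def)
qed

lemma E_n_cong:
  assumes "n \<ge> 1" "\<And>i. i \<in> {1..n} \<Longrightarrow> f i = g i"
  shows "E_n M n f = E_n M n g"
proof -
  have "(\<Prod>i\<in>c. f i x) = (\<Prod>i\<in>c. g i x)" if "c \<subseteq> {1..n}" for c x
    using assms(2) that by (intro prod.cong refl) auto
  then show ?thesis
    unfolding E_n_eq_cycle_sum[OF assms(1)] by (intro arg_cong[of _ _ uminus] cycle_sum_cong) simp
qed

lemma sum_neg_if_nonpos: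
  fixes h :: "'b \<Rightarrow> real"
  assumes "finite A" "\<And>x. x \<in> A \<Longrightarrow> h x \<le> 0" "a \<in> A" "h a < 0"
  shows "(\<Sum>x\<in>A. h x) < 0"
  using sum_strict_mono_ex1[of A h "\<lambda>_. 0"] assms by auto

theorem theoremA4:
  fixes M :: "'a measure" and I :: "('a \<Rightarrow> real) set"
  assumes "prob_space M"
    and "\<And>(n::nat) f. (\<forall>i\<in>{1..n}. f i \<in> I) \<Longrightarrow> integrable M (\<lambda>x. \<Prod>i\<in>{1..n}. f i x)"
  shows "(\<forall>n\<ge>1. \<forall>f. (\<forall>i\<in>{1..n}. f i \<in> I) \<longrightarrow> E_n M n f \<ge> 0) \<longleftrightarrow>
         (\<forall>f. (\<forall>i\<ge>1. f i \<in> insert (\<lambda>_. 0) I) \<longrightarrow>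
              (\<forall>k. fps_nth (positivity_series M f) k \<ge> 0))"
proof (intro iffI allI impI)
  have int: "integrable M (\<lambda>x. \<Prod>i\<in>{1..n}. f (e i) x)"
    if f: "\<forall>i\<ge>1. f i \<in> insert (\<lambda>_. 0) I" and e: "\<forall>i\<in>{1..n}. e i \<ge> 1"
    for f :: "nat \<Rightarrow> 'a \<Rightarrow> real" and e :: "nat \<Rightarrow> nat" and n
  proof (cases "\<exists>i\<in>{1..n}. f (e i) = (\<lambda>_. 0)")
    case True
    then have "(\<lambda>x. \<Prod>i\<in>{1..n}. f (e i) x) = (\<lambda>_. 0)" by (force intro!: prod_zero)
    then show ?thesis by (simp only: integrable_zero)
  next
    case False
    then show ?thesis using f e by (intro assms(2)) blast
  qed
  note coeff = positivity_series_nth[OF int]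
  {
    fix f :: "nat \<Rightarrow> 'a \<Rightarrow> real" and k
    assume pos: "\<forall>n\<ge>1. \<forall>f. (\<forall>i\<in>{1..n}. f i \<in> I) \<longrightarrow> E_n M n f \<ge> 0"
      and f: "\<forall>i\<ge>1. f i \<in> insert (\<lambda>_. 0) I"
    show "fps_nth (positivity_series M f) k \<ge> 0"
    proof (cases "k = 0")
      case True
      then show ?thesis by (simp add: positivity_series_def)
    next
      case False
      have "E_n M n (\<lambda>i. f (e i)) \<ge> 0" if "n \<ge> 1" "e \<in> {1..n} \<rightarrow>\<^sub>E {1..k}" for n e
      proof (cases "\<exists>i\<in>{1..n}. f (e i) = (\<lambda>_. 0)")
        case True
        then show ?thesis using E_n_zero[of _ n "\<lambda>i. f (e i)" M] by auto
      next
        case False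
        have "e i \<ge> 1" if "i \<in> {1..n}" for i using \<open>e \<in> _\<close> that by (auto dest: PiE_mem)
        then have "\<forall>i\<in>{1..n}. f (e i) \<in> I" using False f by blast
        then show ?thesis using pos[rule_format, of n "\<lambda>i. f (e i)"] \<open>n \<ge> 1\<close> by simp
      qed
      then show ?thesis
        using False by (subst coeff[OF f]) (auto intro!: sum_nonneg divide_nonneg_nonneg)
    qed
  next
    fix n :: nat and g :: "nat \<Rightarrow> 'a \<Rightarrow> real"
    assume pos: "\<forall>f. (\<forall>i\<ge>1. f i \<in> insert (\<lambda>_. 0) I) \<longrightarrow> (\<forall>k. fps_nth (positivity_series M f) k \<ge> 0)"
      and n: "n \<ge> 1" and g: "\<forall>i\<in>{1..n}. g i \<in> I"
    have inj: "inj_on (exponent n) {1..n}" using n by (auto simp: inj_on_def exponent_def)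
    define f where "f m = (if m \<in> exponent n ` {1..n}
      then g (the_inv_into {1..n} (exponent n) m) else (\<lambda>_. 0))" for m
    have f_exponent: "f (exponent n i) = g i" if "i \<in> {1..n}" for i
      using that inj by (simp add: f_def the_inv_into_f_f)
    have f: "\<forall>i\<ge>1. f i \<in> insert (\<lambda>_. 0) I"
      using g inj by (auto simp: f_def the_inv_into_f_f)
    \<comment> \<open>The degree in which the coefficient is a positive multiple of \<open>E_n M n g\<close>.\<close>
    define k where "k = (\<Sum>i=1..n. exponent n i)"
    define T :: "nat \<Rightarrow> (nat \<Rightarrow> nat) set" where "T m = {e \<in> {1..m} \<rightarrow>\<^sub>E {1..k}. (\<Sum>i=1..m. e i) = k}" for m
    have contribution: "E_n M m (\<lambda>i. f (e i)) = 0 \<or> (m = n \<and> E_n M m (\<lambda>i. f (e i)) = E_n M n g)"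
      if e: "e \<in> T m" and m: "m \<ge> 1" for m e
    proof (cases "\<forall>i\<in>{1..m}. e i \<in> exponent n ` {1..n}")
      case False
      then obtain i where i: "i \<in> {1..m}" "e i \<notin> exponent n ` {1..n}" by blast
      then have "f (e i) = (\<lambda>_. 0)" by (simp add: f_def)
      with i(1) have "E_n M m (\<lambda>i. f (e i)) = 0" by (intro E_n_zero)
      then show ?thesis by simp
    next
      case True
      then have "\<forall>i\<in>{1..m}. \<exists>j. j \<in> {1..n} \<and> e i = exponent n j" by blast
      then obtain p where p: "\<And>i. i \<in> {1..m} \<Longrightarrow> p i \<in> {1..n} \<and> e i = exponent n (p i)"
        by metis
      have "(\<Sum>i=1..m. exponent n (p i)) = (\<Sum>i=1..n. exponent n i)"
        using e p by (simp add: T_def k_def)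
      then have mn: "m = n" and bij: "bij_betw p {1..n} {1..n}"
        using p sum_exponent_unique[of p m n] by auto
      have "E_n M m (\<lambda>i. f (e i)) = E_n M n (\<lambda>i. g (p i))"
        unfolding mn using p mn by (intro E_n_cong[OF n]) (simp add: f_exponent)
      then show ?thesis using mn E_n_permute[OF bij n, of M g] by simp
    qed
    show "E_n M n g \<ge> 0"
    proof (rule ccontr)
      assume neg: "\<not> E_n M n g \<ge> 0"
      define e where "e = restrict (exponent n) {1..n}"
      have le_k: "exponent n i \<le> k" if "i \<in> {1..n}" for i
        unfolding k_def using that by (intro member_le_sum) auto
      have ge_1: "1 \<le> exponent n i" for i
        by (simp add: exponent_def Suc_le_eq)
      have "(\<Sum>i=1..n. e i) = k" by (simp add: e_def k_def)
      moreover have "e \<in> {1..n} \<rightarrow>\<^sub>E {1..k}" using le_k ge_1 by (auto simp: e_def)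
      ultimately have eT: "e \<in> T n" by (simp add: T_def)
      have finT: "finite (T m)" for m
        unfolding T_def by (rule finite_subset[of _ "{1..m} \<rightarrow>\<^sub>E {1..k}"]) (auto intro: finite_PiE)
      have nonpos: "E_n M m (\<lambda>i. f (e i)) \<le> 0" if "e \<in> T m" "m \<ge> 1" for m e
        using contribution[OF that] neg by auto
      have "n \<le> k"
      proof -
        have "(\<Sum>i=1..n. 1) \<le> k" unfolding k_def by (intro sum_mono ge_1)
        then show ?thesis by simp
      qed
      have "E_n M n (\<lambda>i. f (e i)) = E_n M n g"
        by (intro E_n_cong[OF n]) (simp add: e_def f_exponent)
      then have "(\<Sum>e\<in>T n. E_n M n (\<lambda>i. f (e i))) < 0"
        using nonpos[OF _ n] neg eT by (intro sum_neg_if_nonpos[OF finT]) auto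
      then have "(\<Sum>m=1..k. (\<Sum>e\<in>T m. E_n M m (\<lambda>i. f (e i))) / fact m) < 0"
        using n \<open>n \<le> k\<close> nonpos
        by (intro sum_neg_if_nonpos[of _ _ n] divide_nonpos_pos sum_nonpos) (auto intro: divide_neg_pos)
      moreover have "fps_nth (positivity_series M f) k =
          (\<Sum>m=1..k. (\<Sum>e\<in>T m. E_n M m (\<lambda>i. f (e i))) / fact m)"
        using n \<open>n \<le> k\<close> unfolding T_def by (intro coeff[OF f]) auto
      ultimately show False using pos f by (metis not_le)
    qed
  }
qed

end
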